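(* Let $G$ be a finite group with identity $e_G$, let $S_1,S_2\subseteq G$ be nonempty inverse-closed subsets not containing $e_G$, let $S_3=\{e_G\}$, and let $\Gamma=\mathrm{BiCay}(G;S_1,S_2,S_3)$. Let $\Gamma_0=\mathrm{Cay}(G,S_1)$ and $\Gamma_1=\mathrm{Cay}(G,S_2)$. Then $\omega(\Gamma)=\max\{\omega(\Gamma_0),\omega(\Gamma_1),2\}$.
   Context: $\omega$ denotes the clique number. For an inverse-closed $S\subseteq G$ with $e_G\notin S$, the Cayley graph $\mathrm{Cay}(G,S)$ has vertex set $G$, with $x,y$ adjacent iff $xy^{-1}\in S$. The Bi-Cayley graph $\mathrm{BiCay}(G;S_1,S_2,S_3)$ is the simple graph with vertex set $\{0,1\}\times G$ in which two distinct vertices $(i,x),(j,y)$ are adjacent iff: $xy^{-1}\in S_1$ when $i=j=0$; $xy^{-1}\in S_2$ when $i=j=1$; $xy^{-1}\in S_3$ when $i\ne j$. Thus $\Gamma_0$ and $\Gamma_1$ are identified with the subgraphs of $\Gamma$ induced on $\{0\}\times G$ and $\{1\}\times G$. *)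

theory Defs
  imports "HOL-Algebra.Group" "Graph_Theory.Pair_Digraph"
begin

text \<open>
  A simple graph is a \<^locale>\<open>pair_graph\<close>: finite, loop-free, with a symmetric arc set in which
  each edge occurs as two opposite arcs.
\<close>

definition inverse_closed :: "('a, 'b) monoid_scheme \<Rightarrow> 'a set \<Rightarrow> bool" where
  "inverse_closed G S \<longleftrightarrow> (\<forall>s\<in>S. inv\<^bsub>G\<^esub> s \<in> S)"

definition Cay :: "('a, 'b) monoid_scheme \<Rightarrow> 'a set \<Rightarrow> 'a pair_pre_digraph" where
  "Cay G S = \<lparr> pverts = carrier G,
               parcs = {(x, y). x \<in> carrier G \<and> y \<in> carrier G \<and> x \<otimes>\<^bsub>G\<^esub> inv\<^bsub>G\<^esub> y \<in> S} \<rparr>"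

definition BiCay ::
  "('a, 'b) monoid_scheme \<Rightarrow> 'a set \<Rightarrow> 'a set \<Rightarrow> 'a set \<Rightarrow> (nat \<times> 'a) pair_pre_digraph" where
  "BiCay G S1 S2 S3 =
     \<lparr> pverts = {0, 1} \<times> carrier G,
       parcs = {((i, x), (j, y)).
                  (i, x) \<in> {0, 1} \<times> carrier G \<and> (j, y) \<in> {0, 1} \<times> carrier G \<and>
                  (i, x) \<noteq> (j, y) \<and>
                  (i = 0 \<and> j = 0 \<longrightarrow> x \<otimes>\<^bsub>G\<^esub> inv\<^bsub>G\<^esub> y \<in> S1) \<and>
                  (i = 1 \<and> j = 1 \<longrightarrow> x \<otimes>\<^bsub>G\<^esub> inv\<^bsub>G\<^esub> y \<in> S2) \<and>
                  (i \<noteq> j \<longrightarrow> x \<otimes>\<^bsub>G\<^esub> inv\<^bsub>G\<^esub> y \<in> S3)} \<rparr>"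

definition clique :: "'v pair_pre_digraph \<Rightarrow> 'v set \<Rightarrow> bool" where
  "clique \<Gamma> K \<longleftrightarrow> K \<subseteq> pverts \<Gamma> \<and> (\<forall>u\<in>K. \<forall>v\<in>K. u \<noteq> v \<longrightarrow> (u, v) \<in> parcs \<Gamma>)"

text \<open>Meaningful for finite \<open>\<Gamma>\<close> only, where the set below is finite; it always contains \<open>0\<close>.\<close>

definition clique_number :: "'v pair_pre_digraph \<Rightarrow> nat" where
  "clique_number \<Gamma> = Max {card K | K. clique \<Gamma> K}"

lemma (in group) inverse_closed_swap:
  assumes "inverse_closed G S" "x \<in> carrier G" "y \<in> carrier G" "x \<otimes> inv y \<in> S"
  shows "y \<otimes> inv x \<in> S"
proof -
  have "inv (x \<otimes> inv y) = y \<otimes> inv x"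
    using assms by (simp add: inv_mult_group)
  with assms show ?thesis
    unfolding inverse_closed_def by metis
qed

lemma (in group) pair_graph_Cay:
  assumes "finite (carrier G)" "inverse_closed G S" "\<one> \<notin> S"
  shows "pair_graph (Cay G S)"
proof
  show "finite (parcs (Cay G S))"
    by (rule finite_subset[of _ "carrier G \<times> carrier G"]) (use assms in \<open>auto simp: Cay_def\<close>)
  show "symmetric (with_proj (Cay G S))"
    using assms by (auto simp: symmetric_def Cay_def intro!: symI inverse_closed_swap)
qed (use assms in \<open>auto simp: Cay_def\<close>)

lemma (in group) pair_graph_BiCay:
  assumes "finite (carrier G)" "inverse_closed G S1" "inverse_closed G S2" "inverse_closed G S3"
  shows "pair_graph (BiCay G S1 S2 S3)"
proof
  show "finite (parcs (BiCay G S1 S2 S3))"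
    by (rule finite_subset[of _ "({0, 1} \<times> carrier G) \<times> ({0, 1} \<times> carrier G)"])
      (use assms in \<open>auto simp: BiCay_def\<close>)
  show "symmetric (with_proj (BiCay G S1 S2 S3))"
    using assms by (auto simp: symmetric_def BiCay_def intro!: symI inverse_closed_swap)
qed (use assms in \<open>auto simp: BiCay_def\<close>)

lemma (in group) parcs_BiCay_layer:
  assumes "\<one> \<notin> S1" "\<one> \<notin> S2"
  shows "((0, x), (0, y)) \<in> parcs (BiCay G S1 S2 S3) \<longleftrightarrow> (x, y) \<in> parcs (Cay G S1)"
    and "((1, x), (1, y)) \<in> parcs (BiCay G S1 S2 S3) \<longleftrightarrow> (x, y) \<in> parcs (Cay G S2)"
  using assms by (auto simp: BiCay_def Cay_def)

end

theory Submission
  imports Defs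
begin

text \<open>
  Since \<open>S\<^sub>3 = {\<one>}\<close>, the edges between the two layers form a perfect matching \<open>(0, x) \<longleftrightarrow> (1, x)\<close>.
  A clique meeting both layers therefore consists of the two ends of one matching edge, and any
  other clique lies in a single layer, that is, in a copy of one of the two Cayley graphs.
\<close>

text \<open>\<open>Max\<close> is informative only on a finite set. Cliques are subsets of the
  finite vertex set, so their sizes form part of the image of a finite power set.\<close>

lemma finite_clique_sizes:
  assumes "finite (pverts \<Gamma>)"
  shows "finite {card K | K. clique \<Gamma> K}"
proof -
  have "{card K | K. clique \<Gamma> K} \<subseteq> card ` Pow (pverts \<Gamma>)"
    by (auto simp: clique_def)
  with assms show ?thesis
    by (meson finite_Pow_iff finite_imageI finite_subset)
qed

lemma card_le_clique_number:
  assumes "finite (pverts \<Gamma>)" "clique \<Gamma> K"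
  shows "card K \<le> clique_number \<Gamma>"
  unfolding clique_number_def
  by (rule Max_ge) (use assms finite_clique_sizes in auto)

lemma clique_number_le:
  assumes "finite (pverts \<Gamma>)" "\<And>K. clique \<Gamma> K \<Longrightarrow> card K \<le> m"
  shows "clique_number \<Gamma> \<le> m"
proof -
  \<comment> \<open>The empty clique makes the set of sizes nonempty, as \<open>Max_le_iff\<close>
    requires.\<close>
  have "clique \<Gamma> {}"
    by (simp add: clique_def)
  then have "{card K | K. clique \<Gamma> K} \<noteq> {}"
    by blast
  with assms show ?thesis
    unfolding clique_number_def by (subst Max_le_iff) (auto intro: finite_clique_sizes)
qed

lemma finite_pverts_Cay: "finite (carrier G) \<Longrightarrow> finite (pverts (Cay G S))"
  by (simp add: Cay_def)

lemma finite_pverts_BiCay: "finite (carrier G) \<Longrightarrow> finite (pverts (BiCay G S1 S2 S3))"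
  by (simp add: BiCay_def)

context group
begin

text \<open>\<open>Pair i\<close> is injective and matches the arcs of the Cayley graph with the
  arcs inside layer \<open>i\<close>. Arcs between layers do not enter, so \<open>S3\<close> stays
  arbitrary.\<close>

lemma clique_BiCay_layer:
  assumes "\<one> \<notin> S1" "\<one> \<notin> S2"
  shows "clique (BiCay G S1 S2 S3) (Pair 0 ` K) \<longleftrightarrow> clique (Cay G S1) K"
    and "clique (BiCay G S1 S2 S3) (Pair 1 ` K) \<longleftrightarrow> clique (Cay G S2) K"
  unfolding clique_def using parcs_BiCay_layer[OF assms, of _ _ S3]
  by (auto simp: BiCay_def Cay_def)

text \<open>This is the matching property: a quotient of \<open>x\<close> by \<open>y\<close> equal
  to \<open>\<one>\<close> forces \<open>x = y\<close>.\<close>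

lemma cross_edge_BiCay_one:
  assumes "((i, x), (j, y)) \<in> parcs (BiCay G S1 S2 {\<one>})" "i \<noteq> j"
  shows "x = y"
  using assms by (auto simp: BiCay_def inv_solve_right')

lemma clique_BiCay_one_pair:
  assumes "x \<in> carrier G"
  shows "clique (BiCay G S1 S2 {\<one>}) {(0, x), (1, x)}"
  using assms by (auto simp: clique_def BiCay_def)

lemma clique_BiCay_one_meeting_both_layers:
  assumes K: "clique (BiCay G S1 S2 {\<one>}) K" and x: "(0, x) \<in> K" and y: "(1, y) \<in> K"
  shows "K \<subseteq> {(0, x), (1, x)}"
proof
  fix p assume p: "p \<in> K"
  have cross: "a = b" if "(i, a) \<in> K" "(j, b) \<in> K" "i \<noteq> j" for i j a b
  proof (rule cross_edge_BiCay_one)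
    show "((i, a), (j, b)) \<in> parcs (BiCay G S1 S2 {\<one>})"
      using K that by (auto simp: clique_def)
  qed fact
  obtain i z where iz: "p = (i, z)" "i = 0 \<or> i = 1"
    using K p by (cases p) (auto simp: clique_def BiCay_def)
  have "x = y"
    using cross[OF x y] by simp
  \<comment> \<open>A vertex in layer 0 is compared with \<open>(1, y)\<close>, one in layer 1 with
    \<open>(0, x)\<close>; either way its group element is \<open>x\<close>.\<close>
  with iz p cross[OF _ x, of i z] cross[OF _ y, of i z] show "p \<in> {(0, x), (1, x)}"
    by auto
qed

lemma card_clique_BiCay_one_le:
  assumes fin: "finite (carrier G)" and S: "\<one> \<notin> S1" "\<one> \<notin> S2"
    and K: "clique (BiCay G S1 S2 {\<one>}) K"
  shows "card K \<le> Max {clique_number (Cay G S1), clique_number (Cay G S2), 2}"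
proof -
  have layers: "fst ` K \<subseteq> {0, 1}"
    using K by (auto simp: clique_def BiCay_def)
  \<comment> \<open>The image form of the last two cases exhibits \<open>K\<close> as an embedded
    copy of its projection, ready for \<open>clique_BiCay_layer\<close>. The empty clique falls
    under these cases.\<close>
  consider (both) x y where "(0, x) \<in> K" "(1, y) \<in> K"
    | (zero) "K = Pair 0 ` snd ` K" | (one) "K = Pair 1 ` snd ` K"
  proof (cases "0 \<in> fst ` K \<and> 1 \<in> fst ` K")
    case True
    with both show ?thesis by auto
  next
    case False
    with layers have "(\<forall>p\<in>K. fst p = 0) \<or> (\<forall>p\<in>K. fst p = 1)"
      by force
    with zero one show ?thesis
      by force
  qed
  then show ?thesis
  proof cases
    case both
    \<comment> \<open>Cliques meeting both layers account for the term 2 of the maximum.\<close>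
    then have "card K \<le> card {(0::nat, x), (1, x)}"
      using clique_BiCay_one_meeting_both_layers[OF K] by (intro card_mono) auto
    then show ?thesis by simp
  next
    case zero
    with K have "clique (Cay G S1) (snd ` K)"
      using clique_BiCay_layer(1)[OF S] by metis
    then have "card (snd ` K) \<le> clique_number (Cay G S1)"
      by (intro card_le_clique_number finite_pverts_Cay fin)
    moreover have "card K = card (snd ` K)"
      by (subst zero) (simp add: card_image inj_on_def)
    ultimately show ?thesis by simp
  next
    case one
    with K have "clique (Cay G S2) (snd ` K)"
      using clique_BiCay_layer(2)[OF S] by metis
    then have "card (snd ` K) \<le> clique_number (Cay G S2)"
      by (intro card_le_clique_number finite_pverts_Cay fin)
    moreover have "card K = card (snd ` K)"
      by (subst one) (simp add: card_image inj_on_def)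
    ultimately show ?thesis by simp
  qed
qed

text \<open>Embedding a clique of a Cayley graph into its layer gives a clique of the same size in
  the larger graph.\<close>

lemma clique_number_Cay_le_BiCay:
  assumes fin: "finite (carrier G)" and S: "\<one> \<notin> S1" "\<one> \<notin> S2"
  shows "clique_number (Cay G S1) \<le> clique_number (BiCay G S1 S2 S3)"
    and "clique_number (Cay G S2) \<le> clique_number (BiCay G S1 S2 S3)"
proof -
  have card_layer: "card (Pair i ` K) = card K" for i :: nat and K :: "'a set"
    by (simp add: card_image inj_on_def)
  note le = card_le_clique_number[OF finite_pverts_BiCay[OF fin], of S1 S2 S3]
  show "clique_number (Cay G S1) \<le> clique_number (BiCay G S1 S2 S3)"
    using le clique_BiCay_layer(1)[OF S] card_layer
    by (intro clique_number_le finite_pverts_Cay fin) metis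
  show "clique_number (Cay G S2) \<le> clique_number (BiCay G S1 S2 S3)"
    using le clique_BiCay_layer(2)[OF S] card_layer
    by (intro clique_number_le finite_pverts_Cay fin) metis
qed

end

theorem theorem2p51:
  fixes G :: "('a, 'b) monoid_scheme" and S1 S2 :: "'a set"
  assumes "group G" and "finite (carrier G)"
    and "S1 \<subseteq> carrier G" and "S1 \<noteq> {}" and "inverse_closed G S1" and "\<one>\<^bsub>G\<^esub> \<notin> S1"
    and "S2 \<subseteq> carrier G" and "S2 \<noteq> {}" and "inverse_closed G S2" and "\<one>\<^bsub>G\<^esub> \<notin> S2"
  shows "clique_number (BiCay G S1 S2 {\<one>\<^bsub>G\<^esub>}) =
           Max {clique_number (Cay G S1), clique_number (Cay G S2), 2}"
proof -
  interpret group G by fact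
  note fin = \<open>finite (carrier G)\<close> and S = \<open>\<one>\<^bsub>G\<^esub> \<notin> S1\<close> \<open>\<one>\<^bsub>G\<^esub> \<notin> S2\<close>
  show ?thesis
  proof (rule antisym)
    show "clique_number (BiCay G S1 S2 {\<one>\<^bsub>G\<^esub>})
        \<le> Max {clique_number (Cay G S1), clique_number (Cay G S2), 2}"
      by (intro clique_number_le finite_pverts_BiCay card_clique_BiCay_one_le fin S)
    \<comment> \<open>The lower bound 2 comes from one matching edge; the identity is an element of
      \<open>G\<close> always at hand.\<close>
    have "card {(0::nat, \<one>\<^bsub>G\<^esub>), (1, \<one>\<^bsub>G\<^esub>)} \<le> clique_number (BiCay G S1 S2 {\<one>\<^bsub>G\<^esub>})"
      by (intro card_le_clique_number finite_pverts_BiCay clique_BiCay_one_pair fin one_closed)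
    with clique_number_Cay_le_BiCay[OF fin S, of "{\<one>\<^bsub>G\<^esub>}"]
    show "Max {clique_number (Cay G S1), clique_number (Cay G S2), 2}
        \<le> clique_number (BiCay G S1 S2 {\<one>\<^bsub>G\<^esub>})"
      by simp
  qed
qed

end
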